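(* Let $\theta\in(0,1)$ be irrational and let $h:\mathbb{R}\to\mathbb{R}^2$, $h(t)=(t,\theta t)$. Let $g:[0,1]\to\mathbb{R}^2$ be a continuous curve such that (1) there exists $\epsilon>0$ such that for all $(x,y)\in g([0,1])$ and $t\in\mathbb{R}$, $(x,y)+h(t)\in g([0,1])$ only if $t=0$ or $|t|>\epsilon$; (2) $g(1)-g(0)\in\mathbb{Z}^2$; (3) $\varGamma:=\mathbb{Z}^2+g([0,1])$ does not intersect itself. Assume moreover that $g$ is non-linear, i.e. that its image $g([0,1])$ is not contained in a straight line. Then $$\mathcal{L}_{\varGamma,\theta}:=\{t\in\mathbb{R}:(t,\theta t)\in\varGamma\}=h^{-1}(\varGamma)$$ is a Delone set in $\mathbb{R}$ whose Dirac comb $\delta_{\mathcal{L}_{\varGamma,\theta}}=\sum_{t\in\mathcal{L}_{\varGamma,\theta}}\delta_t$ is strongly almost periodic, and $\mathcal{L}_{\varGamma,\theta}$ is not completely periodic.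
   Context: Condition (3) means that the closed curve $s\mapsto g(s)+\mathbb{Z}^2$ on the torus $\mathbb{R}^2/\mathbb{Z}^2$ is simple: for $s<s'$ in $[0,1]$, $g(s)-g(s')\in\mathbb{Z}^2$ only if $s=0$ and $s'=1$. A subset $A\subset\mathbb{R}$ is relatively dense if there is a compact $K\subset\mathbb{R}$ with $A+K=\mathbb{R}$. A subset $\mathcal{L}\subset\mathbb{R}$ is uniformly discrete if there is an open neighborhood $U$ of $0$ with $(x+U)\cap(y+U)=\emptyset$ for all $x\ne y$ in $\mathcal{L}$; it is a Delone set if it is uniformly discrete and relatively dense. It is completely periodic (crystalline) if its set of periods $\{t\in\mathbb{R}:t+\mathcal{L}=\mathcal{L}\}$ is relatively dense in $\mathbb{R}$. Here $\delta_t$ is the unit point mass at $t$. A (complex regular Borel) measure $\nu$ on $\mathbb{R}$ is translation bounded if for some (equivalently every) nonempty open relatively compact $V\subset\mathbb{R}$ there is $C\ge0$ with $|\nu|(t+V)\le C$ for all $t\in\mathbb{R}$. For $\varphi\in C_c(\mathbb{R})$, $(\nu*\varphi)(s)=\int\varphi(s-u)\,d\nu(u)$. A bounded continuous function $f$ on $\mathbb{R}$ is (Bohr) almost periodic if for every $\epsilon>0$ the set of $t\in\mathbb{R}$ with $\sup_{s\in\mathbb{R}}|f(s-t)-f(s)|\le\epsilon$ is relatively dense. A translation bounded measure $\nu$ is strongly almost periodic if $\nu*\varphi$ is Bohr almost periodic for every $\varphi\in C_c(\mathbb{R})$. *)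

theory Defs
  imports "HOL-Analysis.Analysis" "HOL-Probability.Giry_Monad"
begin

definition relatively_dense :: "real set \<Rightarrow> bool" where
  "relatively_dense A \<longleftrightarrow> (\<exists>K. compact K \<and> {a + k | a k. a \<in> A \<and> k \<in> K} = UNIV)"

definition uniformly_discrete :: "real set \<Rightarrow> bool" where
  "uniformly_discrete L \<longleftrightarrow>
     (\<exists>U. open U \<and> 0 \<in> U \<and> (\<forall>x\<in>L. \<forall>y\<in>L. x \<noteq> y \<longrightarrow> (+) x ` U \<inter> (+) y ` U = {}))"

definition Delone :: "real set \<Rightarrow> bool" where
  "Delone L \<longleftrightarrow> uniformly_discrete L \<and> relatively_dense L"

definition completely_periodic :: "real set \<Rightarrow> bool" where
  "completely_periodic L \<longleftrightarrow> relatively_dense {t. (+) t ` L = L}"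

text \<open>
  Measures are taken to be positive Borel measures, so that the total variation of \<open>\<nu>\<close> is
  \<open>\<nu>\<close> itself. Translation boundedness implies local finiteness, hence regularity, on the real line.
\<close>

definition translation_bounded :: "real measure \<Rightarrow> bool" where
  "translation_bounded \<nu> \<longleftrightarrow> sets \<nu> = sets borel \<and>
     (\<exists>V. open V \<and> V \<noteq> {} \<and> compact (closure V) \<and>
       (\<exists>C\<ge>0. \<forall>t. emeasure \<nu> ((+) t ` V) \<le> ennreal C))"

definition compactly_supported_continuous :: "(real \<Rightarrow> complex) set" where
  "compactly_supported_continuous =
     {\<phi>. continuous_on UNIV \<phi> \<and> compact (closure (support_on UNIV \<phi>))}"

definition measure_conv :: "real measure \<Rightarrow> (real \<Rightarrow> complex) \<Rightarrow> real \<Rightarrow> complex" where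
  "measure_conv \<nu> \<phi> s = (LINT u|\<nu>. \<phi> (s - u))"

definition Bohr_almost_periodic :: "(real \<Rightarrow> complex) \<Rightarrow> bool" where
  "Bohr_almost_periodic f \<longleftrightarrow> continuous_on UNIV f \<and> bounded (range f) \<and>
     (\<forall>\<epsilon>>0. relatively_dense {t. (SUP s. norm (f (s - t) - f s)) \<le> \<epsilon>})"

definition strongly_almost_periodic :: "real measure \<Rightarrow> bool" where
  "strongly_almost_periodic \<nu> \<longleftrightarrow> translation_bounded \<nu> \<and>
     (\<forall>\<phi>\<in>compactly_supported_continuous. Bohr_almost_periodic (measure_conv \<nu> \<phi>))"

definition Dirac_comb :: "real set \<Rightarrow> real measure" where
  "Dirac_comb L = measure_of UNIV (sets borel) (\<lambda>A. \<Sum>\<^sub>\<infinity>t\<in>L. emeasure (return borel t) A)"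

lemma sets_Dirac_comb: "sets (Dirac_comb L) = sets borel"
  unfolding Dirac_comb_def by (metis sets.sets_measure_of_eq space_borel)

text \<open>
  \<open>measure_of\<close> silently yields the null measure for a set function that is not countably additive;
  the following shows that this never happens here.
\<close>

lemma emeasure_Dirac_comb:
  assumes "A \<in> sets borel"
  shows "emeasure (Dirac_comb L) A = (\<Sum>\<^sub>\<infinity>t\<in>L. emeasure (return borel t) A)"
proof -
  define N where "N = distr (count_space L) borel (\<lambda>t::real. t)"
  have N: "emeasure N A = (\<Sum>\<^sub>\<infinity>t\<in>L. emeasure (return borel t) A)" if A: "A \<in> sets borel" for A
  proof -
    have "emeasure N A = emeasure (count_space L) (A \<inter> L)"
      unfolding N_def using A by (subst emeasure_distr) auto
    also have "\<dots> = (\<Sum>\<^sub>\<infinity>t\<in>A \<inter> L. 1)"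
      by (cases "finite (A \<inter> L)") (simp_all add: infsum_superconst_infinite_ennreal[where b = 1])
    also have "\<dots> = (\<Sum>\<^sub>\<infinity>t\<in>L. emeasure (return borel t) A)"
      using A by (intro infsum_cong_neutral) auto
    finally show ?thesis .
  qed
  have "Dirac_comb L = measure_of UNIV (sets borel) (emeasure N)"
    unfolding Dirac_comb_def
    by (rule measure_of_eq) (auto simp: N sets.sigma_sets_eq[of borel, simplified])
  also have "\<dots> = N"
    using measure_of_of_measure[of N] by (simp add: N_def)
  finally show ?thesis using N assms by simp
qed

definition slope_line :: "real \<Rightarrow> real \<Rightarrow> real \<times> real" where
  "slope_line \<theta> t = (t, \<theta> * t)"

definition lattice_translates :: "(real \<Rightarrow> real \<times> real) \<Rightarrow> (real \<times> real) set" where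
  "lattice_translates g = {z + p | z p. z \<in> \<int> \<times> \<int> \<and> p \<in> g ` {0..1}}"

definition hitting_set :: "(real \<Rightarrow> real \<times> real) \<Rightarrow> real \<Rightarrow> real set" where
  "hitting_set g \<theta> = {t. slope_line \<theta> t \<in> lattice_translates g}"

end

theory Submission
  imports Defs
begin

text \<open>
  Measure the position of a point transversally to the flow lines by \<open>f (x, y) = y - \<theta> * x\<close>, which
  is constant along the direction \<open>(1, \<theta>)\<close>. The separation condition makes \<open>f\<close> locally injective
  along the curve, hence injective on all of it (\<open>locally_injective_imp_inj_on\<close>). So the curve can
  be reparametrised by \<open>f\<close>: after dividing by the total increment \<open>c = b - \<theta> * a\<close> of \<open>f\<close>, where
  \<open>(a, b)\<close> is the lattice vector joining the end points, its lift to the plane is the graph of a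
  linear function plus a continuous function \<open>\<Psi>\<close> of period one (\<open>transversal_curve_lift\<close>).

  As the curve is simple on the torus, \<open>a\<close> and \<open>b\<close> are coprime (\<open>coprime_winding\<close>). The lattice
  translates of the lift are then indexed by a single integer \<open>k\<close>, and the flow line through the
  origin meets the \<open>k\<close>-th one at exactly one time, \<open>t k = k / c + \<Phi> (k * \<alpha>)\<close>, where \<open>\<Phi>\<close> is a
  translate of \<open>\<Psi>\<close> up to a constant and \<open>\<alpha>\<close> is irrational (\<open>hits_eq_range\<close>). The hitting set is
  therefore an arithmetic progression whose points are displaced by a continuous function sampled
  along an irrational rotation.

  For such modulated progressions everything is elementary. Distinct translates of the curve are
  disjoint, so consecutive points never collide, and by compactness their gaps are bounded below;
  since \<open>\<Phi>\<close> is bounded, the set is Delone. If \<open>m * \<alpha>\<close> is close to an integer, which happens for a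
  relatively dense set of \<open>m\<close>, the shift by \<open>m / c\<close> moves every point close to the point \<open>m\<close>
  places further, and only boundedly many points enter a convolution with a compactly supported
  function; this gives strong almost periodicity. Finally, a nonzero period must shift the indices
  by some \<open>m\<close>; density of the rotation orbit turns this into invariance of \<open>\<Phi>\<close> under the irrational
  number \<open>m * \<alpha>\<close>, so \<open>\<Phi>\<close> is constant and the curve is a straight segment.
\<close>

section \<open>Periodic functions and irrational rotations\<close>

lemma periodic_one_bounded:
  fixes \<Phi> :: "real \<Rightarrow> real"
  assumes "continuous_on UNIV \<Phi>" and per: "\<And>x. \<Phi> (x + 1) = \<Phi> x"
  obtains B where "B > 0" "\<And>x. \<bar>\<Phi> x\<bar> \<le> B"
proof -
  interpret periodic_fun_simple' \<Phi> by standard (rule per)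
  have "compact (\<Phi> ` {0..1})"
    using assms(1) by (intro compact_continuous_image) (auto intro: continuous_on_subset)
  then obtain B where B: "B > 0" "\<forall>y\<in>\<Phi> ` {0..1}. \<bar>y\<bar> \<le> B"
    using compact_imp_bounded bounded_pos by (metis real_norm_def)
  have "\<bar>\<Phi> x\<bar> \<le> B" for x
  proof -
    have "\<Phi> x = \<Phi> (frac x)"
      using minus_of_int[of x "\<lfloor>x\<rfloor>"] by (simp add: frac_def)
    moreover have "frac x \<in> {0..1}" by (simp add: frac_ge_0 less_imp_le[OF frac_lt_1])
    ultimately show ?thesis using B(2) by auto
  qed
  with B(1) show ?thesis using that by blast
qed

lemma periodic_one_uniformly_continuous:
  fixes \<Phi> :: "real \<Rightarrow> real"
  assumes "continuous_on UNIV \<Phi>" and per: "\<And>x. \<Phi> (x + 1) = \<Phi> x" and "\<eta> > 0"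
  obtains d where "d > 0" "\<And>x y. \<bar>x - y\<bar> < d \<Longrightarrow> \<bar>\<Phi> x - \<Phi> y\<bar> < \<eta>"
proof -
  interpret periodic_fun_simple' \<Phi> by standard (rule per)
  have "uniformly_continuous_on {-1..2} \<Phi>"
    using assms(1) by (intro compact_uniformly_continuous) (auto intro: continuous_on_subset)
  then obtain d where d: "d > 0"
    "\<And>x y. x \<in> {-1..2} \<Longrightarrow> y \<in> {-1..2} \<Longrightarrow> \<bar>x - y\<bar> < d \<Longrightarrow> \<bar>\<Phi> x - \<Phi> y\<bar> < \<eta>"
    using \<open>\<eta> > 0\<close> unfolding uniformly_continuous_on_def dist_real_def by (metis abs_minus_commute)
  show ?thesis
  proof (rule that[of "min d 1"])
    show "min d 1 > 0" using d(1) by simp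
    fix x y :: real assume xy: "\<bar>x - y\<bar> < min d 1"
    let ?n = "\<lfloor>x\<rfloor>"
    have "0 \<le> x - ?n" "x - ?n \<le> 1" by linarith+
    then have "x - ?n \<in> {-1..2}" "y - ?n \<in> {-1..2}" using xy by (simp_all, linarith+)
    then show "\<bar>\<Phi> x - \<Phi> y\<bar> < \<eta>"
      using d(2)[of "x - ?n" "y - ?n"] xy minus_of_int[of x ?n] minus_of_int[of y ?n] by auto
  qed
qed

text \<open>
  The points \<open>k * \<alpha>\<close> are dense modulo one, so by uniform continuity the value \<open>C\<close> spreads to all
  of the real line.
\<close>
lemma constant_along_irrational_rotation:
  fixes h :: "real \<Rightarrow> real"
  assumes cont: "continuous_on UNIV h" and per: "\<And>x. h (x + 1) = h x"
    and irr: "\<alpha> \<notin> \<rat>" and C: "\<And>k::int. h (of_int k * \<alpha>) = C"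
  shows "h x = C"
proof (rule ccontr)
  interpret periodic_fun_simple' h by standard (rule per)
  assume "h x \<noteq> C"
  then have "\<bar>h x - C\<bar> > 0" by simp
  from periodic_one_uniformly_continuous[where \<Phi> = h, OF cont per this] obtain d where
    d: "d > 0" "\<And>u v. \<bar>u - v\<bar> < d \<Longrightarrow> \<bar>h u - h v\<bar> < \<bar>h x - C\<bar>" by blast
  obtain m k where "\<bar>of_int k * \<alpha> - of_int m - x\<bar> < d"
    using sequence_of_fractional_parts_is_dense[OF irr d(1), of x] by blast
  then have "\<bar>h x - h (of_int k * \<alpha> - of_int m)\<bar> < \<bar>h x - C\<bar>"
    by (intro d(2)) (simp add: abs_minus_commute)
  then show False using minus_of_int[of "of_int k * \<alpha>" m] C[of k] by simp
qed

text \<open>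
  Two multiples of \<open>\<alpha>\<close> whose fractional parts lie in the same box of length \<open>1 / N\<close> differ by
  almost an integer. As there are finitely many boxes, subtracting from \<open>k\<close> a fixed representative
  of its box changes \<open>k\<close> only by a bounded amount: the near returns are relatively dense.
\<close>
lemma rotation_near_returns:
  fixes \<alpha> d :: real
  assumes "d > 0"
  obtains J where "finite J" "\<And>k::int. \<exists>j\<in>J. \<exists>n::int. \<bar>of_int (k - j) * \<alpha> - of_int n\<bar> < d"
proof -
  obtain N :: nat where N: "1 / N < d" "N > 0"
    by (metis \<open>d > 0\<close> gr_zeroI inverse_eq_divide real_arch_inverse)
  define box where "box k = \<lfloor>N * frac (of_int k * \<alpha>)\<rfloor>" for k :: int
  define rep where "rep i = (SOME k. box k = i)" for i
  have "box k \<in> {0..<int N}" for k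
    using N(2) frac_ge_0[of "of_int k * \<alpha>"] frac_lt_1[of "of_int k * \<alpha>"]
    by (auto simp: box_def floor_less_iff)
  then have "finite (range box)"
    by (meson finite_atLeastLessThan_int finite_subset image_subsetI)
  moreover have "\<exists>j\<in>rep ` range box. \<exists>n::int. \<bar>of_int (k - j) * \<alpha> - of_int n\<bar> < d" for k
  proof -
    define j where "j = rep (box k)"
    have "box j = box k" unfolding j_def rep_def by (rule someI) (rule refl)
    then have "\<bar>N * frac (of_int k * \<alpha>) - N * frac (of_int j * \<alpha>)\<bar> < 1"
      unfolding box_def by linarith
    then have "N * \<bar>frac (of_int k * \<alpha>) - frac (of_int j * \<alpha>)\<bar> < 1"
      by (simp add: abs_mult flip: right_diff_distrib)
    then have "\<bar>frac (of_int k * \<alpha>) - frac (of_int j * \<alpha>)\<bar> < 1 / N"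
      using N(2) by (simp add: field_simps)
    moreover have "frac (of_int k * \<alpha>) - frac (of_int j * \<alpha>)
        = of_int (k - j) * \<alpha> - of_int (\<lfloor>of_int k * \<alpha>\<rfloor> - \<lfloor>of_int j * \<alpha>\<rfloor>)"
      by (simp add: frac_def algebra_simps)
    ultimately have "\<bar>of_int (k - j) * \<alpha> - of_int (\<lfloor>of_int k * \<alpha>\<rfloor> - \<lfloor>of_int j * \<alpha>\<rfloor>)\<bar> < d"
      using N(1) by linarith
    then show ?thesis unfolding j_def by blast
  qed
  ultimately show ?thesis using that by blast
qed

text \<open>
  Around an integer, the extension is glued from the two copies of \<open>f\<close> on the adjacent unit
  intervals, which agree at their common end point because \<open>f 0 = f 1\<close>.
\<close>
lemma continuous_on_periodic_extension:
  fixes f :: "real \<Rightarrow> 'a::topological_space"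
  assumes cont: "continuous_on {0..1} f" and "f 0 = f 1"
  shows "continuous_on UNIV (\<lambda>x. f (frac x))"
proof -
  let ?F = "\<lambda>x. f (frac x)"
  have piece: "continuous_on {real_of_int n..real_of_int n + 1} ?F" for n
  proof -
    have "continuous_on {real_of_int n..real_of_int n + 1} (\<lambda>x. f (x - of_int n))"
      by (rule continuous_on_compose2[OF cont]) (auto intro!: continuous_intros)
    moreover have "f (frac x) = f (x - of_int n)" if "x \<in> {real_of_int n..real_of_int n + 1}" for x
    proof (cases "x = of_int n + 1")
      case True
      then show ?thesis using \<open>f 0 = f 1\<close> by simp
    next
      case False
      then have "frac x = x - of_int n" using that by (subst frac_unique_iff) auto
      then show ?thesis by simp
    qed
    ultimately show ?thesis using continuous_on_cong by (metis (no_types, lifting))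
  qed
  have "isCont ?F x" for x
  proof -
    define n where "n = \<lfloor>x\<rfloor>"
    have "continuous_on ({real_of_int (n - 1)..real_of_int (n - 1) + 1} \<union> {real_of_int n..real_of_int n + 1}) ?F"
      by (intro continuous_on_closed_Un piece) auto
    moreover have "{real_of_int (n - 1)..real_of_int (n - 1) + 1} \<union> {real_of_int n..real_of_int n + 1}
        = {real_of_int n - 1..real_of_int n + 1}" by auto
    moreover have "x \<in> interior {real_of_int n - 1..real_of_int n + 1}"
      unfolding n_def interior_atLeastAtMost_real by (auto; linarith)
    ultimately show ?thesis using continuous_on_interior by metis
  qed
  then show ?thesis by (simp add: continuous_at_imp_continuous_on)
qed

text \<open>
  At a maximum \<open>x\<^sub>0\<close> the increment \<open>\<Phi> (x + h) - \<Phi> x\<close> is nonpositive, and at \<open>x\<^sub>0 - h\<close> it is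
  nonnegative; in between it vanishes.
\<close>
lemma periodic_one_chord:
  fixes \<Phi> :: "real \<Rightarrow> real"
  assumes cont: "continuous_on UNIV \<Phi>" and per: "\<And>x. \<Phi> (x + 1) = \<Phi> x"
  obtains x where "\<Phi> (x + h) = \<Phi> x"
proof -
  interpret periodic_fun_simple' \<Phi> by standard (rule per)
  obtain x0 where x0: "\<forall>y\<in>{0..1}. \<Phi> y \<le> \<Phi> x0"
    using continuous_attains_sup[of "{0..1}" \<Phi>] continuous_on_subset[OF cont] by auto
  have top: "\<Phi> y \<le> \<Phi> x0" for y
  proof -
    have "\<Phi> y = \<Phi> (frac y)" using minus_of_int[of y "\<lfloor>y\<rfloor>"] by (simp add: frac_def)
    then show ?thesis using bspec[OF x0, of "frac y"] by (simp add: less_imp_le[OF frac_lt_1])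
  qed
  define D where "D x = \<Phi> (x + h) - \<Phi> x" for x
  have "continuous_on UNIV D"
    unfolding D_def by (intro continuous_intros cont continuous_on_compose2[OF cont]) auto
  then have "connected (range D)" by (rule connected_continuous_image) simp
  moreover have "D x0 \<le> 0" "0 \<le> D (x0 - h)" using top by (simp_all add: D_def)
  ultimately have "0 \<in> range D" using connectedD_interval by (metis rangeI)
  then show ?thesis using that by (auto simp: D_def)
qed

section \<open>Dirac combs and test functions\<close>

lemma relatively_denseI:
  assumes "\<And>y. \<exists>a\<in>A. \<bar>y - a\<bar> \<le> R"
  shows "relatively_dense A"
  unfolding relatively_dense_def
proof (intro exI conjI)
  show "compact {-R..R}" by simp
  have "y \<in> {a + k |a k. a \<in> A \<and> k \<in> {-R..R}}" for y
  proof -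
    from assms[of y] obtain a where "a \<in> A" "\<bar>y - a\<bar> \<le> R" by blast
    then show ?thesis by (intro CollectI exI[of _ a] exI[of _ "y - a"]) auto
  qed
  then show "{a + k |a k. a \<in> A \<and> k \<in> {-R..R}} = UNIV" by blast
qed

text \<open>
  Indexing the points by the integers turns the comb into an image of counting measure, so that
  measures and integrals reduce to counting indices and summing over them.
\<close>
lemma Dirac_comb_range:
  fixes t :: "int \<Rightarrow> real"
  assumes "inj t"
  shows "Dirac_comb (range t) = distr (count_space UNIV) borel t"
proof (rule measure_eqI)
  show "sets (Dirac_comb (range t)) = sets (distr (count_space UNIV) borel t)"
    by (simp add: sets_Dirac_comb)
  fix A assume "A \<in> sets (Dirac_comb (range t))"
  then have A: "A \<in> sets borel" by (simp add: sets_Dirac_comb)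
  have "emeasure (Dirac_comb (range t)) A = (\<Sum>\<^sub>\<infinity>k. emeasure (return borel (t k)) A)"
    by (simp add: emeasure_Dirac_comb[OF A] infsum_reindex[OF assms] o_def)
  also have "\<dots> = (\<Sum>\<^sub>\<infinity>k\<in>t -` A. 1)"
    using A by (intro infsum_cong_neutral) auto
  also have "\<dots> = emeasure (count_space UNIV) (t -` A)"
    by (cases "finite (t -` A)") (simp_all add: infsum_superconst_infinite_ennreal[where b = 1])
  also have "\<dots> = emeasure (distr (count_space UNIV) borel t) A"
    using A by (subst emeasure_distr) auto
  finally show "emeasure (Dirac_comb (range t)) A = emeasure (distr (count_space UNIV) borel t) A" .
qed

lemma compactly_supported_bound:
  assumes "\<phi> \<in> compactly_supported_continuous"
  obtains R where "R > 0" "\<And>x. \<phi> x \<noteq> 0 \<Longrightarrow> \<bar>x\<bar> \<le> R"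
proof -
  have "bounded (support_on UNIV \<phi>)"
    using assms bounded_subset[OF compact_imp_bounded closure_subset]
    by (auto simp: compactly_supported_continuous_def)
  then obtain R where "R > 0" "\<forall>x\<in>support_on UNIV \<phi>. norm x \<le> R" by (auto simp: bounded_pos)
  then show ?thesis using that by (auto simp: support_on_def)
qed

lemma compactly_supported_uniformly_continuous:
  assumes "\<phi> \<in> compactly_supported_continuous" and "e > 0"
  obtains d where "d > 0" "\<And>x y. \<bar>x - y\<bar> < d \<Longrightarrow> norm (\<phi> x - \<phi> y) < e"
proof -
  obtain R where R: "R > 0" "\<And>x. \<phi> x \<noteq> 0 \<Longrightarrow> \<bar>x\<bar> \<le> R"
    using compactly_supported_bound[OF assms(1)] by blast
  have "uniformly_continuous_on {-R-1..R+1} \<phi>"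
    using assms(1) unfolding compactly_supported_continuous_def
    by (intro compact_uniformly_continuous) (auto intro: continuous_on_subset)
  then obtain d where d: "d > 0"
    "\<And>x y. x \<in> {-R-1..R+1} \<Longrightarrow> y \<in> {-R-1..R+1} \<Longrightarrow> \<bar>x - y\<bar> < d \<Longrightarrow> norm (\<phi> x - \<phi> y) < e"
    using \<open>e > 0\<close> unfolding uniformly_continuous_on_def dist_norm real_norm_def
    by (metis abs_minus_commute norm_minus_commute)
  show ?thesis
  proof (rule that[of "min d 1"])
    fix x y :: real assume xy: "\<bar>x - y\<bar> < min d 1"
    show "norm (\<phi> x - \<phi> y) < e"
    proof (cases "\<phi> x = 0 \<and> \<phi> y = 0")
      case False
      then have "\<bar>x\<bar> \<le> R \<or> \<bar>y\<bar> \<le> R" using R(2) by blast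
      then show ?thesis using xy by (intro d(2)) auto
    qed (use \<open>e > 0\<close> in simp)
  qed (use d in simp)
qed

lemma compactly_supported_bounded:
  assumes "\<phi> \<in> compactly_supported_continuous"
  obtains M where "M > 0" "\<And>x. norm (\<phi> x) \<le> M"
proof -
  obtain R where R: "R > 0" "\<And>x. \<phi> x \<noteq> 0 \<Longrightarrow> \<bar>x\<bar> \<le> R"
    using compactly_supported_bound[OF assms(1)] by blast
  have "compact (\<phi> ` {-R..R})"
    using assms(1) unfolding compactly_supported_continuous_def
    by (intro compact_continuous_image) (auto intro: continuous_on_subset)
  then obtain M where "M > 0" "\<forall>y\<in>\<phi> ` {-R..R}. norm y \<le> M"
    using compact_imp_bounded bounded_pos by metis
  then have "norm (\<phi> x) \<le> M" for x
    using R(2)[of x] by (cases "\<phi> x = 0") (auto simp: abs_le_iff)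
  then show ?thesis using that \<open>M > 0\<close> by blast
qed

section \<open>Modulated lattices\<close>

text \<open>
  The points \<open>r * k + \<Phi> (k * \<alpha>)\<close> of a progression modulated by a function of period one along a
  rotation. The last assumption says that neighbours stay distinct, not only along the orbit of
  the rotation but at every phase \<open>x\<close>.
\<close>
locale modulated_lattice =
  fixes r \<alpha> :: real and \<Phi> :: "real \<Rightarrow> real"
  assumes r_pos: "r > 0"
    and cont: "continuous_on UNIV \<Phi>"
    and periodic: "\<Phi> (x + 1) = \<Phi> x"
    and no_collision: "r + \<Phi> (x + \<alpha>) - \<Phi> x \<noteq> 0"
begin

sublocale periodic_fun_simple' \<Phi> by standard (rule periodic)

definition pt :: "int \<Rightarrow> real" where
  "pt k = r * of_int k + \<Phi> (of_int k * \<alpha>)"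

lemma modulation_bounded:
  obtains B where "B > 0" "\<And>x. \<bar>\<Phi> x\<bar> \<le> B"
  by (rule periodic_one_bounded[where \<Phi> = \<Phi>, OF cont periodic]) (rule that)

lemma cont_translate: "continuous_on A (\<lambda>x. \<Phi> (x + c))"
  by (rule continuous_on_compose2[OF cont]) (auto intro!: continuous_intros)

text \<open>
  The gap is a nowhere vanishing continuous function of the phase, so it has constant sign. The sign
  is that of \<open>r\<close>: over \<open>n\<close> steps the gaps add up to \<open>r * n\<close> up to a bounded error.
\<close>
lemma gap_pos: "r + \<Phi> (x + \<alpha>) - \<Phi> x > 0"
proof (rule ccontr)
  define H where "H x = r + \<Phi> (x + \<alpha>) - \<Phi> x" for x
  have contH: "continuous_on UNIV H"
    unfolding H_def by (intro continuous_intros cont_translate cont)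
  obtain B where B: "B > 0" "\<And>x. \<bar>\<Phi> x\<bar> \<le> B"
    using modulation_bounded by blast
  assume "\<not> r + \<Phi> (x + \<alpha>) - \<Phi> x > 0"
  then have x: "H x < 0" using no_collision[of x] by (simp add: H_def)
  have neg: "H y < 0" for y
  proof (rule ccontr)
    assume "\<not> H y < 0"
    then have "0 \<in> H ` UNIV"
      using x connectedD_interval[OF connected_continuous_image[OF contH connected_UNIV],
          of "H x" "H y" 0] by auto
    then show False using no_collision by (auto simp: H_def)
  qed
  \<comment> \<open>The left-hand side telescopes into the sum of the first \<open>n\<close> gaps.\<close>
  have "r * of_nat n + \<Phi> (of_nat n * \<alpha>) - \<Phi> 0 \<le> 0" for n
  proof (induction n)
    case (Suc n)
    then show ?case using neg[of "of_nat n * \<alpha>"] by (simp add: H_def algebra_simps)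
  qed simp
  moreover obtain n :: nat where "2 * B / r < n" using reals_Archimedean2 by blast
  then have "r * of_nat n > 2 * B" using r_pos by (simp add: field_simps)
  ultimately show False
    using B(2)[of "of_nat n * \<alpha>"] B(2)[of 0] by (smt (verit))
qed

text \<open>
  By periodicity, the minimum of the gap over one period is its minimum over all phases.
\<close>
lemma gap_bounded_below:
  obtains \<delta> where "\<delta> > 0" "\<And>x. r + \<Phi> (x + \<alpha>) - \<Phi> x \<ge> \<delta>"
proof -
  define H where "H x = r + \<Phi> (x + \<alpha>) - \<Phi> x" for x
  have "continuous_on {0..1} H"
    unfolding H_def by (intro continuous_intros cont_translate) (auto intro: continuous_on_subset[OF cont])
  then obtain x0 where x0: "x0 \<in> {0..1}" "\<And>y. y \<in> {0..1} \<Longrightarrow> H x0 \<le> H y"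
    using continuous_attains_inf[of "{0..1}" H] by auto
  have "H x0 \<le> H x" for x
  proof -
    have "H x = H (frac x)"
      using minus_of_int[of x "\<lfloor>x\<rfloor>"] minus_of_int[of "x + \<alpha>" "\<lfloor>x\<rfloor>"]
      by (simp add: H_def frac_def algebra_simps)
    then show ?thesis using x0(2)[of "frac x"] by (simp add: frac_ge_0 less_imp_le[OF frac_lt_1])
  qed
  then show ?thesis using that[of "H x0"] gap_pos by (simp add: H_def)
qed

lemma pt_step: "pt (k + 1) - pt k = r + \<Phi> (of_int k * \<alpha> + \<alpha>) - \<Phi> (of_int k * \<alpha>)"
  by (simp add: pt_def distrib_left distrib_right)

lemma pt_separated:
  obtains \<delta> where "\<delta> > 0" "\<And>k l. \<delta> * \<bar>of_int k - of_int l\<bar> \<le> \<bar>pt k - pt l\<bar>"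
proof -
  obtain \<delta> where \<delta>: "\<delta> > 0" "\<And>x. r + \<Phi> (x + \<alpha>) - \<Phi> x \<ge> \<delta>"
    using gap_bounded_below by blast
  have up: "\<delta> * of_int (l - k) \<le> pt l - pt k" if "k \<le> l" for k l
    using that
  proof (induction l rule: int_ge_induct)
    case (step i)
    then show ?case using \<delta>(2)[of "of_int i * \<alpha>"] pt_step[of i] by (simp add: algebra_simps)
  qed simp
  have "\<delta> * \<bar>of_int k - of_int l\<bar> \<le> \<bar>pt k - pt l\<bar>" for k l
    using up[of k l] up[of l k] by (cases "k \<le> l") (auto simp: abs_if)
  then show ?thesis using that \<delta>(1) by blast
qed

lemma strict_mono_pt: "strict_mono pt"
proof (rule strict_monoI)
  fix k l :: int assume "k < l"
  then show "pt k < pt l"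
  proof (induction rule: int_gr_induct)
    case base then show ?case using gap_pos[of "of_int k * \<alpha>"] pt_step[of k] by simp
  next
    case (step i) then show ?case using gap_pos[of "of_int i * \<alpha>"] pt_step[of i] by simp
  qed
qed

lemma inj_pt: "inj pt"
  using strict_mono_pt by (rule strict_mono_imp_inj_on)

text \<open>
  Points are \<open>\<delta>\<close>-separated in the index, so the indices seen in a window of radius \<open>R\<close> differ from
  each other by at most \<open>2 * R / \<delta>\<close>, wherever the window is centred. This uniform count is what
  makes all sums over the comb below uniformly finite.
\<close>
lemma window_card:
  obtains N :: nat where "\<And>s. finite {k. \<bar>s - pt k\<bar> \<le> R}" "\<And>s. card {k. \<bar>s - pt k\<bar> \<le> R} \<le> N"
proof -
  obtain \<delta> where \<delta>: "\<delta> > 0" "\<And>k l. \<delta> * \<bar>of_int k - of_int l\<bar> \<le> \<bar>pt k - pt l\<bar>"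
    using pt_separated by blast
  define M where "M = \<lceil>2 * R / \<delta>\<rceil>"
  have sub: "\<exists>k0. {k. \<bar>s - pt k\<bar> \<le> R} \<subseteq> {k0 - M..k0 + M}" for s
  proof (cases "{k. \<bar>s - pt k\<bar> \<le> R} = {}")
    case False
    then obtain k0 where k0: "\<bar>s - pt k0\<bar> \<le> R" by blast
    have "k \<in> {k0 - M..k0 + M}" if "\<bar>s - pt k\<bar> \<le> R" for k
    proof -
      have "\<delta> * \<bar>of_int k - of_int k0\<bar> \<le> 2 * R" using \<delta>(2)[of k k0] k0 that by linarith
      then have "\<bar>of_int k - of_int k0\<bar> \<le> 2 * R / \<delta>" using \<delta>(1) by (simp add: field_simps)
      then have "\<bar>of_int k - of_int k0\<bar> \<le> real_of_int M" unfolding M_def by linarith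
      then have "\<bar>k - k0\<bar> \<le> M" by linarith
      then show ?thesis by auto
    qed
    then show ?thesis by blast
  qed auto
  have "finite {k. \<bar>s - pt k\<bar> \<le> R}" for s
    using sub[of s] finite_subset by (metis finite_atLeastAtMost_int)
  moreover have "card {k. \<bar>s - pt k\<bar> \<le> R} \<le> nat (2 * M + 1)" for s
  proof -
    obtain k0 where "{k. \<bar>s - pt k\<bar> \<le> R} \<subseteq> {k0 - M..k0 + M}" using sub by blast
    from card_mono[OF _ this] show ?thesis by simp
  qed
  ultimately show ?thesis using that by blast
qed

lemma Delone_pt: "Delone (range pt)"
  unfolding Delone_def
proof
  obtain \<delta> where \<delta>: "\<delta> > 0" "\<And>k l. \<delta> * \<bar>of_int k - of_int l\<bar> \<le> \<bar>pt k - pt l\<bar>"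
    using pt_separated by blast
  have sep: "\<delta> \<le> \<bar>x - y\<bar>" if xy: "x \<in> range pt" "y \<in> range pt" "x \<noteq> y" for x y
  proof -
    obtain k l where kl: "x = pt k" "y = pt l" using xy by blast
    then have "k \<noteq> l" using xy by auto
    then have "\<bar>real_of_int k - of_int l\<bar> \<ge> 1" by linarith
    then have "\<delta> * 1 \<le> \<delta> * \<bar>real_of_int k - of_int l\<bar>" using \<delta>(1) by (intro mult_left_mono) auto
    then show ?thesis using \<delta>(2)[of k l] kl by simp
  qed
  show "uniformly_discrete (range pt)"
    unfolding uniformly_discrete_def
  proof (intro exI conjI ballI impI)
    show "open {-\<delta>/2<..<\<delta>/2}" "0 \<in> {-\<delta>/2<..<\<delta>/2}" using \<delta>(1) by auto
    fix x y assume "x \<in> range pt" "y \<in> range pt" "x \<noteq> y"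
    from sep[OF this] show "(+) x ` {-\<delta>/2<..<\<delta>/2} \<inter> (+) y ` {-\<delta>/2<..<\<delta>/2} = {}" by auto
  qed
  obtain B where B: "B > 0" "\<And>x. \<bar>\<Phi> x\<bar> \<le> B"
    using modulation_bounded by blast
  show "relatively_dense (range pt)"
  proof (rule relatively_denseI[where R = "r + B"])
    fix y
    have "\<bar>y - r * of_int \<lfloor>y / r\<rfloor>\<bar> \<le> r"
      using floor_divide_lower[OF r_pos, of y] floor_divide_upper[OF r_pos, of y]
      by (simp add: algebra_simps abs_if)
    then have "\<bar>y - pt \<lfloor>y / r\<rfloor>\<bar> \<le> r + B"
      using B(2)[of "of_int \<lfloor>y / r\<rfloor> * \<alpha>"] unfolding pt_def by linarith
    then show "\<exists>a\<in>range pt. \<bar>y - a\<bar> \<le> r + B" by blast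
  qed
qed

lemma translation_bounded_pt: "translation_bounded (Dirac_comb (range pt))"
proof -
  obtain N where N: "\<And>s. finite {k. \<bar>s - pt k\<bar> \<le> 1}" "\<And>s. card {k. \<bar>s - pt k\<bar> \<le> 1} \<le> N"
    using window_card by blast
  show ?thesis
    unfolding translation_bounded_def
  proof (intro conjI exI allI impI)
  show "0 \<le> real N" by simp
  show "sets (Dirac_comb (range pt)) = sets borel" by (rule sets_Dirac_comb)
  show "open {-1<..<1::real}" "{-1<..<1::real} \<noteq> {}" "compact (closure {-1<..<1::real})" by auto
  fix s :: real
  let ?V = "(+) s ` {-1<..<1}"
  have sub: "pt -` ?V \<subseteq> {k. \<bar>s - pt k\<bar> \<le> 1}" by auto
  have V: "?V \<in> sets borel" by (intro borel_open open_translation) simp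
  have "emeasure (Dirac_comb (range pt)) ?V = emeasure (count_space UNIV) (pt -` ?V)"
    by (subst Dirac_comb_range[OF inj_pt], subst emeasure_distr[OF _ V]) simp_all
  also have "\<dots> = of_nat (card (pt -` ?V))"
    using finite_subset[OF sub N(1)] by simp
  also have "\<dots> \<le> of_nat N" by (rule of_nat_mono[OF le_trans[OF card_mono[OF N(1) sub] N(2)]])
  finally show "emeasure (Dirac_comb (range pt)) ?V \<le> ennreal (real N)"
    by (simp add: ennreal_of_nat_eq_real_of_nat)
  qed
qed

lemma measure_conv_pt:
  assumes phi: "\<phi> \<in> compactly_supported_continuous"
  shows "measure_conv (Dirac_comb (range pt)) \<phi> s = (\<Sum>\<^sub>\<infinity>k. \<phi> (s - pt k))"
proof -
  obtain R where R: "R > 0" "\<And>x. \<phi> x \<noteq> 0 \<Longrightarrow> \<bar>x\<bar> \<le> R"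
    using compactly_supported_bound[OF phi] by blast
  obtain N where N: "\<And>s. finite {k. \<bar>s - pt k\<bar> \<le> R}" "\<And>s. card {k. \<bar>s - pt k\<bar> \<le> R} \<le> N"
    using window_card by blast
  have fin: "finite {k. \<phi> (s - pt k) \<noteq> 0}"
    by (rule finite_subset[OF _ N(1)[of s]]) (use R(2) in auto)
  have "continuous_on UNIV \<phi>" using phi by (simp add: compactly_supported_continuous_def)
  then have "continuous_on UNIV (\<lambda>u. \<phi> (s - u))"
    by (rule continuous_on_compose2) (auto intro!: continuous_intros)
  then have "(\<lambda>u. \<phi> (s - u)) \<in> borel_measurable borel"
    by (rule borel_measurable_continuous_onI)
  then have "measure_conv (Dirac_comb (range pt)) \<phi> s = (LINT k|count_space UNIV. \<phi> (s - pt k))"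
    unfolding measure_conv_def Dirac_comb_range[OF inj_pt] by (subst integral_distr) simp_all
  also have "\<dots> = (\<Sum>k | \<phi> (s - pt k) \<noteq> 0. \<phi> (s - pt k))"
    using lebesgue_integral_count_space_finite_support[of UNIV "\<lambda>k. \<phi> (s - pt k)"] fin by simp
  also have "\<dots> = (\<Sum>\<^sub>\<infinity>k\<in>{k. \<phi> (s - pt k) \<noteq> 0}. \<phi> (s - pt k))" using fin by simp
  also have "\<dots> = (\<Sum>\<^sub>\<infinity>k. \<phi> (s - pt k))" by (rule infsum_cong_neutral) auto
  finally show ?thesis .
qed

text \<open>
  Uniform continuity of \<open>\<phi>\<close> controls each term, and only boundedly many terms are nonzero, so moving
  all points a little changes the sum by little, uniformly in \<open>s\<close>. The offset \<open>c\<close> covers both uses: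
  continuity of the sum in \<open>s\<close>, where it is a small translation, and almost periods, where it is a
  large one compensated by a shift of indices.
\<close>
lemma sum_perturbation:
  assumes phi: "\<phi> \<in> compactly_supported_continuous" and "e > 0"
  obtains \<eta> where "\<eta> > 0"
    "\<And>c t' s. (\<And>k. \<bar>pt k + c - t' k\<bar> < \<eta>) \<Longrightarrow>
       norm ((\<Sum>\<^sub>\<infinity>k. \<phi> (s - (pt k + c))) - (\<Sum>\<^sub>\<infinity>k. \<phi> (s - t' k))) \<le> e"
proof -
  obtain R where R: "R > 0" "\<And>x. \<phi> x \<noteq> 0 \<Longrightarrow> \<bar>x\<bar> \<le> R"
    using compactly_supported_bound[OF phi] by blast
  obtain N where N: "\<And>s. finite {k. \<bar>s - pt k\<bar> \<le> R + 1}" "\<And>s. card {k. \<bar>s - pt k\<bar> \<le> R + 1} \<le> N"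
    using window_card by blast
  have "e / (real N + 1) > 0" using \<open>e > 0\<close> by simp
  then obtain d where d: "d > 0" "\<And>x y. \<bar>x - y\<bar> < d \<Longrightarrow> norm (\<phi> x - \<phi> y) < e / (real N + 1)"
    using compactly_supported_uniformly_continuous[OF phi] by blast
  show ?thesis
  proof (rule that[of "min d 1"])
    show "min d 1 > 0" using d(1) by simp
    fix c s :: real and t' :: "int \<Rightarrow> real"
    assume close: "\<And>k. \<bar>pt k + c - t' k\<bar> < min d 1"
    \<comment> \<open>Radius \<open>R + 1\<close> instead of \<open>R\<close>, so that the displaced points outside the window miss the support as well.\<close>
    define A where "A = {k. \<bar>(s - c) - pt k\<bar> \<le> R + 1}"
    have A: "finite A" "card A \<le> N" unfolding A_def by (rule N)+
    have off: "\<phi> (s - (pt k + c)) = 0" "\<phi> (s - t' k) = 0" if "k \<notin> A" for k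
    proof -
      have "\<bar>s - c - pt k\<bar> > R + 1" using that by (simp add: A_def)
      then have "\<bar>s - (pt k + c)\<bar> > R" "\<bar>s - t' k\<bar> > R" using close[of k] by linarith+
      then show "\<phi> (s - (pt k + c)) = 0" "\<phi> (s - t' k) = 0" using R(2) by fastforce+
    qed
    have "(\<Sum>\<^sub>\<infinity>k. \<phi> (s - (pt k + c))) = (\<Sum>k\<in>A. \<phi> (s - (pt k + c)))"
      using off(1) by (subst infsum_finite[OF A(1), symmetric]) (rule infsum_cong_neutral, auto)
    moreover have "(\<Sum>\<^sub>\<infinity>k. \<phi> (s - t' k)) = (\<Sum>k\<in>A. \<phi> (s - t' k))"
      using off(2) by (subst infsum_finite[OF A(1), symmetric]) (rule infsum_cong_neutral, auto)
    ultimately have "norm ((\<Sum>\<^sub>\<infinity>k. \<phi> (s - (pt k + c))) - (\<Sum>\<^sub>\<infinity>k. \<phi> (s - t' k)))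
        = norm (\<Sum>k\<in>A. \<phi> (s - (pt k + c)) - \<phi> (s - t' k))"
      by (simp add: sum_subtractf)
    also have "\<dots> \<le> of_nat (card A) * (e / (real N + 1))"
    proof (rule sum_norm_bound)
      fix k
      have "\<bar>(s - (pt k + c)) - (s - t' k)\<bar> < d" using close[of k] by linarith
      then show "norm (\<phi> (s - (pt k + c)) - \<phi> (s - t' k)) \<le> e / (real N + 1)"
        using d(2) by (simp add: less_imp_le)
    qed
    also have "\<dots> \<le> (real N + 1) * (e / (real N + 1))"
      using A(2) \<open>e > 0\<close> by (intro mult_right_mono) auto
    also have "\<dots> = e" by simp
    finally show "norm ((\<Sum>\<^sub>\<infinity>k. \<phi> (s - (pt k + c))) - (\<Sum>\<^sub>\<infinity>k. \<phi> (s - t' k))) \<le> e" .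
  qed
qed

text \<open>
  If \<open>m * \<alpha>\<close> is close to an integer, then \<open>\<Phi>\<close> hardly changes under translation by \<open>m * \<alpha>\<close>, and
  translating the points by \<open>r * m\<close> is almost the same as shifting their index by \<open>m\<close>. Such
  translations occur within distance \<open>R\<close> of every real \<open>y\<close>.
\<close>
lemma almost_period:
  assumes "\<eta> > 0"
  obtains R where "\<And>y. \<exists>m::int. \<bar>y - r * of_int m\<bar> \<le> R \<and> (\<forall>k. \<bar>pt k + r * of_int m - pt (k + m)\<bar> < \<eta>)"
proof -
  obtain d where d: "d > 0" "\<And>x y. \<bar>x - y\<bar> < d \<Longrightarrow> \<bar>\<Phi> x - \<Phi> y\<bar> < \<eta>"
    using periodic_one_uniformly_continuous[where \<Phi> = \<Phi>, OF cont periodic \<open>\<eta> > 0\<close>] by blast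
  obtain J where J: "finite J"
    "\<And>k::int. \<exists>j\<in>J. \<exists>n::int. \<bar>of_int (k - j) * \<alpha> - of_int n\<bar> < d"
    using rotation_near_returns[OF d(1)] by blast
  have "bounded ((\<lambda>j. r * real_of_int j) ` J)" using J(1) by (intro finite_imp_bounded) auto
  then obtain b where b: "\<And>j. j \<in> J \<Longrightarrow> \<bar>r * real_of_int j\<bar> \<le> b" by (auto simp: bounded_iff)
  show ?thesis
  proof (rule that[of "r + b"])
    fix y
    define k where "k = \<lfloor>y / r\<rfloor>"
    obtain j n where j: "j \<in> J" and n: "\<bar>of_int (k - j) * \<alpha> - of_int n\<bar> < d" using J(2) by blast
    have "\<bar>y - r * of_int k\<bar> \<le> r"
      using floor_divide_lower[OF r_pos, of y] floor_divide_upper[OF r_pos, of y]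
      by (simp add: k_def algebra_simps abs_if)
    then have "\<bar>y - r * of_int (k - j)\<bar> \<le> r + b"
      using b[OF j] by (simp add: algebra_simps abs_le_iff)
    moreover have "\<bar>pt l + r * of_int (k - j) - pt (l + (k - j))\<bar> < \<eta>" for l
    proof -
      have "\<bar>\<Phi> (of_int l * \<alpha>) - \<Phi> (of_int (l + (k - j)) * \<alpha> - of_int n)\<bar> < \<eta>"
        using n by (intro d(2)) (simp add: algebra_simps abs_minus_commute abs_less_iff)
      then show ?thesis unfolding minus_of_int pt_def by (simp add: algebra_simps)
    qed
    ultimately show "\<exists>m::int. \<bar>y - r * of_int m\<bar> \<le> r + b \<and>
        (\<forall>k. \<bar>pt k + r * of_int m - pt (k + m)\<bar> < \<eta>)" by blast
  qed
qed

lemma Bohr_almost_periodic_pt: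
  assumes phi: "\<phi> \<in> compactly_supported_continuous"
  shows "Bohr_almost_periodic (measure_conv (Dirac_comb (range pt)) \<phi>)"
proof -
  define f where "f s = (\<Sum>\<^sub>\<infinity>k. \<phi> (s - pt k))" for s
  have f: "measure_conv (Dirac_comb (range pt)) \<phi> = f"
    unfolding f_def by (rule ext) (rule measure_conv_pt[OF phi])
  have shift: "(\<Sum>\<^sub>\<infinity>k. \<phi> (s - pt (k + m))) = f s" for s m
  proof -
    have "surj (\<lambda>k::int. k + m)" by (rule surjI[of _ "\<lambda>k. k - m"]) simp
    then show ?thesis
      unfolding f_def using infsum_reindex[of "\<lambda>k::int. k + m" UNIV "\<lambda>k. \<phi> (s - pt k)"]
      by (simp add: o_def inj_on_def)
  qed
  have "continuous_on UNIV f"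
    unfolding continuous_on_iff
  proof (intro ballI allI impI)
    fix s e :: real assume "e > 0"
    then have "e / 2 > 0" by simp
    from sum_perturbation[OF phi this] obtain \<eta> where \<eta>: "\<eta> > 0"
      "\<And>c t' s. (\<And>k. \<bar>pt k + c - t' k\<bar> < \<eta>) \<Longrightarrow>
         norm ((\<Sum>\<^sub>\<infinity>k. \<phi> (s - (pt k + c))) - (\<Sum>\<^sub>\<infinity>k. \<phi> (s - t' k))) \<le> e / 2" by blast
    have "norm (f s' - f s) < e" if "dist s' s < \<eta>" for s'
    proof -
      have "norm ((\<Sum>\<^sub>\<infinity>k. \<phi> (s - (pt k + (s - s')))) - (\<Sum>\<^sub>\<infinity>k. \<phi> (s - pt k))) \<le> e / 2"
        by (rule \<eta>(2)) (use that in \<open>simp add: dist_real_def abs_minus_commute\<close>)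
      then show ?thesis using \<open>e > 0\<close> by (simp add: f_def algebra_simps)
    qed
    then show "\<exists>d>0. \<forall>s'\<in>UNIV. dist s' s < d \<longrightarrow> dist (f s') (f s) < e"
      using \<eta>(1) by (auto simp: dist_norm)
  qed
  moreover have "bounded (range f)"
  proof -
    obtain R where R: "R > 0" "\<And>x. \<phi> x \<noteq> 0 \<Longrightarrow> \<bar>x\<bar> \<le> R"
      using compactly_supported_bound[OF phi] by blast
    obtain N where N: "\<And>s. finite {k. \<bar>s - pt k\<bar> \<le> R}" "\<And>s. card {k. \<bar>s - pt k\<bar> \<le> R} \<le> N"
      using window_card by blast
    obtain M where M: "M > 0" "\<And>x. norm (\<phi> x) \<le> M"
      using compactly_supported_bounded[OF phi] by blast
    have "norm (f s) \<le> real N * M" for s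
    proof -
      have "f s = (\<Sum>\<^sub>\<infinity>k\<in>{k. \<bar>s - pt k\<bar> \<le> R}. \<phi> (s - pt k))"
        unfolding f_def by (rule infsum_cong_neutral) (use R(2) in auto)
      also have "\<dots> = (\<Sum>k\<in>{k. \<bar>s - pt k\<bar> \<le> R}. \<phi> (s - pt k))" using N(1) by simp
      finally have "norm (f s) \<le> of_nat (card {k. \<bar>s - pt k\<bar> \<le> R}) * M"
        using sum_norm_bound[of _ "\<lambda>k. \<phi> (s - pt k)" M] M(2) by simp
      also have "\<dots> \<le> real N * M" using N(2)[of s] M(1) by (intro mult_right_mono) auto
      finally show ?thesis .
    qed
    then show ?thesis by (auto simp: bounded_iff)
  qed
  moreover have "relatively_dense {\<tau>. (SUP s. norm (f (s - \<tau>) - f s)) \<le> e}" if "e > 0" for e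
  proof -
    from sum_perturbation[OF phi that] obtain \<eta> where \<eta>: "\<eta> > 0"
      "\<And>c t' s. (\<And>k. \<bar>pt k + c - t' k\<bar> < \<eta>) \<Longrightarrow>
         norm ((\<Sum>\<^sub>\<infinity>k. \<phi> (s - (pt k + c))) - (\<Sum>\<^sub>\<infinity>k. \<phi> (s - t' k))) \<le> e" by blast
    obtain R where R: "\<And>y. \<exists>m::int. \<bar>y - r * of_int m\<bar> \<le> R \<and>
        (\<forall>k. \<bar>pt k + r * of_int m - pt (k + m)\<bar> < \<eta>)" using almost_period[OF \<eta>(1)] by blast
    show ?thesis
    proof (rule relatively_denseI[where R = R])
      fix y
      obtain m :: int where m: "\<bar>y - r * of_int m\<bar> \<le> R"
        "\<And>k. \<bar>pt k + r * of_int m - pt (k + m)\<bar> < \<eta>" using R by blast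
      have "norm (f (s - r * of_int m) - f s) \<le> e" for s
        using \<eta>(2)[where c = "r * of_int m" and t' = "\<lambda>k. pt (k + m)" and s = s, OF m(2)]
        unfolding shift by (simp add: f_def algebra_simps)
      then have "(SUP s. norm (f (s - r * of_int m) - f s)) \<le> e" by (intro cSUP_least) auto
      with m(1) show "\<exists>a\<in>{\<tau>. (SUP s. norm (f (s - \<tau>) - f s)) \<le> e}. \<bar>y - a\<bar> \<le> R" by blast
    qed
  qed
  ultimately show ?thesis unfolding f Bohr_almost_periodic_def by blast
qed

lemma strongly_almost_periodic_pt: "strongly_almost_periodic (Dirac_comb (range pt))"
  unfolding strongly_almost_periodic_def
  using translation_bounded_pt Bohr_almost_periodic_pt by blast

text \<open>
  A period induces an order-preserving bijection of the indices, and every such bijection of the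
  integers is a translation.
\<close>
lemma period_shifts_index:
  assumes "(+) \<tau> ` range pt = range pt"
  obtains m where "\<And>k. pt k + \<tau> = pt (k + m)"
proof -
  have "\<exists>l. pt k + \<tau> = pt l" for k
    using assms by (metis add.commute imageI rangeI rangeE)
  then obtain \<sigma> where \<sigma>: "\<And>k. pt k + \<tau> = pt (\<sigma> k)" by metis
  have less: "\<sigma> k < \<sigma> l \<longleftrightarrow> k < l" for k l
    using strict_mono_less[OF strict_mono_pt, of "\<sigma> k" "\<sigma> l"]
      strict_mono_less[OF strict_mono_pt, of k l] \<sigma>[of k] \<sigma>[of l] by (metis add_less_cancel_right)
  have onto: "\<exists>k. \<sigma> k = l" for l
  proof -
    have "pt l \<in> (+) \<tau> ` range pt" using assms by auto
    then obtain k where "pt l = \<tau> + pt k" by blast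
    then have "pt l = pt (\<sigma> k)" using \<sigma>[of k] by simp
    then show ?thesis using inj_pt by (metis injD)
  qed
  have step: "\<sigma> (k + 1) = \<sigma> k + 1" for k
  proof (rule ccontr)
    assume "\<sigma> (k + 1) \<noteq> \<sigma> k + 1"
    moreover have "\<sigma> k < \<sigma> (k + 1)" by (simp add: less)
    ultimately have lt: "\<sigma> k < \<sigma> k + 1" "\<sigma> k + 1 < \<sigma> (k + 1)" by auto
    obtain l where "\<sigma> l = \<sigma> k + 1" using onto by blast
    then have "k < l" "l < k + 1" using lt less[of k l] less[of l "k + 1"] by simp_all
    then show False by simp
  qed
  have "\<sigma> k = k + \<sigma> 0" for k
  proof (induction k rule: int_induct[where k = 0])
    case (step1 i) then show ?case using step[of i] by simp
  next
    case (step2 i) then show ?case using step[of "i - 1"] by simp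
  qed simp
  then show ?thesis using that[of "\<sigma> 0"] \<sigma> by metis
qed

text \<open>
  The index shift \<open>m\<close> belonging to \<open>\<tau>\<close> gives \<open>\<Phi> (x + m * \<alpha>) = \<Phi> x + e\<close> with a constant \<open>e\<close>, first
  on the orbit of the rotation and then by density everywhere. Iterating, boundedness of \<open>\<Phi>\<close> forces
  \<open>e = 0\<close>; then \<open>\<tau> = r * m\<close>, so \<open>m\<close> is nonzero, and \<open>\<Phi>\<close> has the irrational period \<open>m * \<alpha>\<close> besides
  the period one.
\<close>
lemma period_imp_constant:
  assumes irr: "\<alpha> \<notin> \<rat>" and "\<tau> \<noteq> 0" and "(+) \<tau> ` range pt = range pt"
  shows "\<Phi> x = \<Phi> 0"
proof -
  obtain m where m: "\<And>k. pt k + \<tau> = pt (k + m)" using period_shifts_index[OF assms(3)] by blast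
  define e where "e = \<tau> - r * of_int m"
  define h where "h x = \<Phi> (x + of_int m * \<alpha>) - \<Phi> x" for x
  have h: "h x = e" for x
  proof (rule constant_along_irrational_rotation[where h = h, OF _ _ irr])
    show "continuous_on UNIV h" unfolding h_def by (intro continuous_intros cont cont_translate)
    show "h (x + 1) = h x" for x
      using periodic[of "x + of_int m * \<alpha>"] periodic[of x] by (simp add: h_def algebra_simps)
    show "h (of_int k * \<alpha>) = e" for k
      using m[of k] by (simp add: pt_def e_def h_def algebra_simps)
  qed
  have iter: "\<Phi> (of_nat n * (of_int m * \<alpha>)) = \<Phi> 0 + of_nat n * e" for n
  proof (induction n)
    case (Suc n)
    then show ?case using h[of "of_nat n * (of_int m * \<alpha>)"] by (simp add: h_def algebra_simps)
  qed simp
  obtain B where B: "B > 0" "\<And>x. \<bar>\<Phi> x\<bar> \<le> B"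
    using modulation_bounded by blast
  have "e = 0"
  proof (rule ccontr)
    assume "e \<noteq> 0"
    obtain n :: nat where "2 * B / \<bar>e\<bar> < n" using reals_Archimedean2 by blast
    then have "2 * B < \<bar>of_nat n * e\<bar>" using \<open>e \<noteq> 0\<close> by (simp add: field_simps abs_mult)
    then show False using iter[of n] B(2)[of 0] B(2)[of "of_nat n * (of_int m * \<alpha>)"] by linarith
  qed
  then have "m \<noteq> 0" using \<open>\<tau> \<noteq> 0\<close> by (auto simp: e_def)
  have "of_int m * \<alpha> \<notin> \<rat>"
  proof
    assume "of_int m * \<alpha> \<in> \<rat>"
    then have "of_int m * \<alpha> / of_int m \<in> \<rat>" by (intro Rats_divide Rats_of_int)
    then show False using irr \<open>m \<noteq> 0\<close> by simp
  qed
  then show ?thesis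
  proof (rule constant_along_irrational_rotation[where h = \<Phi>, OF cont periodic])
    show "\<Phi> (of_int k * (of_int m * \<alpha>)) = \<Phi> 0" for k
    proof (induction k rule: int_induct[where k = 0])
      case (step1 i)
      then show ?case using h[of "of_int i * (of_int m * \<alpha>)"] \<open>e = 0\<close> by (simp add: h_def algebra_simps)
    next
      case (step2 i)
      then show ?case using h[of "of_int (i - 1) * (of_int m * \<alpha>)"] \<open>e = 0\<close> by (simp add: h_def algebra_simps)
    qed simp
  qed
qed

lemma not_completely_periodic_pt:
  assumes "\<alpha> \<notin> \<rat>" and "\<Phi> x \<noteq> \<Phi> 0"
  shows "\<not> completely_periodic (range pt)"
proof
  assume "completely_periodic (range pt)"
  then obtain K where K: "compact K"
    "{a + k |a k. a \<in> {t. (+) t ` range pt = range pt} \<and> k \<in> K} = UNIV"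
    unfolding completely_periodic_def relatively_dense_def by blast
  have "{t. (+) t ` range pt = range pt} \<subseteq> {0}"
    using period_imp_constant[OF assms(1)] assms(2) by blast
  then have "UNIV \<subseteq> K" using K(2) by force
  then show False using compact_imp_bounded[OF K(1)] not_bounded_UNIV[where 'a = real] bounded_subset by blast
qed

end

section \<open>Closed curves transversal to an irrational flow\<close>

text \<open>
  If two points \<open>s < s'\<close> had the same value, then \<open>f\<close> would either be constant on \<open>{s..s'}\<close> or attain an
  extremum in the interior. Neither is possible for a function that is injective, hence strictly
  monotone, near every interior point.
\<close>
lemma locally_injective_imp_inj_on:
  fixes f :: "real \<Rightarrow> real"
  assumes cont: "continuous_on {a..b} f" and "d > 0"
    and loc: "\<And>s s'. s \<in> {a..b} \<Longrightarrow> s' \<in> {a..b} \<Longrightarrow> \<bar>s - s'\<bar> < d \<Longrightarrow> f s = f s' \<Longrightarrow> s = s'"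
  shows "inj_on f {a..b}"
proof -
  have False if ss: "s \<in> {a..b}" "s' \<in> {a..b}" "s < s'" and eq: "f s = f s'" for s s'
  proof -
    have sub: "{s..s'} \<subseteq> {a..b}" using ss by auto
    then have contS: "continuous_on {s..s'} f" using cont continuous_on_subset by blast
    have no_extremum: "\<not> (\<forall>y\<in>{s..s'}. f y \<le> f \<xi>)" "\<not> (\<forall>y\<in>{s..s'}. f \<xi> \<le> f y)"
      if "s < \<xi>" "\<xi> < s'" for \<xi>
    proof -
      \<comment> \<open>A third of \<open>d\<close> keeps the neighbourhood of \<open>\<xi>\<close> shorter than \<open>d\<close>.\<close>
      define \<eta> where "\<eta> = min (d / 3) (min (\<xi> - s) (s' - \<xi>))"
      have "\<eta> > 0" using that \<open>d > 0\<close> by (simp add: \<eta>_def)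
      moreover have "\<eta> \<le> d / 3" "\<eta> \<le> \<xi> - s" "\<eta> \<le> s' - \<xi>" unfolding \<eta>_def by linarith+
      ultimately have \<eta>: "\<eta> > 0" "\<eta> \<le> d / 3" "{\<xi> - \<eta>..\<xi> + \<eta>} \<subseteq> {s..s'}" by auto
      have "inj_on f {\<xi> - \<eta>..\<xi> + \<eta>}"
      proof (rule inj_onI)
        fix x y assume x: "x \<in> {\<xi> - \<eta>..\<xi> + \<eta>}" and y: "y \<in> {\<xi> - \<eta>..\<xi> + \<eta>}" and "f x = f y"
        have "\<bar>x - y\<bar> \<le> 2 * \<eta>" using x y by (simp add: abs_le_iff)
        then have "\<bar>x - y\<bar> < d" using \<eta>(2) \<open>d > 0\<close> by linarith
        then show "x = y" using x y \<eta>(3) sub \<open>f x = f y\<close> loc by blast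
      qed
      moreover have "continuous_on {\<xi> - \<eta>..\<xi> + \<eta>} f" using contS \<eta>(3) continuous_on_subset by blast
      ultimately have "f (\<xi> - \<eta>) < f \<xi> \<and> f \<xi> < f (\<xi> + \<eta>) \<or> f (\<xi> + \<eta>) < f \<xi> \<and> f \<xi> < f (\<xi> - \<eta>)"
        using \<eta>(1) by (intro continuous_inj_imp_mono) auto
      moreover have "\<xi> - \<eta> \<in> {s..s'}" "\<xi> + \<eta> \<in> {s..s'}" using \<eta>(1,3) by auto
      ultimately show "\<not> (\<forall>y\<in>{s..s'}. f y \<le> f \<xi>)" "\<not> (\<forall>y\<in>{s..s'}. f \<xi> \<le> f y)"
        by (meson not_less)+
    qed
    obtain u where u: "u \<in> {s..s'}" "\<forall>y\<in>{s..s'}. f y \<le> f u"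
      using continuous_attains_sup[of "{s..s'}" f] contS ss(3) by auto
    obtain v where v: "v \<in> {s..s'}" "\<forall>y\<in>{s..s'}. f v \<le> f y"
      using continuous_attains_inf[of "{s..s'}" f] contS ss(3) by auto
    have "u = s \<or> u = s'" "v = s \<or> v = s'"
      using no_extremum[of u] no_extremum[of v] u v by fastforce+
    then have const: "f y = f s" if "y \<in> {s..s'}" for y
      using u(2) v(2) that eq by (metis order_antisym)
    define y where "y = s + min (d / 2) (s' - s)"
    have "y \<in> {s..s'}" "y \<noteq> s" "\<bar>s - y\<bar> < d" using ss(3) \<open>d > 0\<close> unfolding y_def by auto
    then show False using loc[of s y] const[of y] ss(1) sub by auto
  qed
  then show ?thesis unfolding inj_on_def by (metis linorder_neqE_linordered_idom)
qed

text \<open>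
  The lift of a closed curve on the torus, parametrised by the transversal coordinate: the point
  \<open>(u, v)\<close> with parameter \<open>x\<close> satisfies \<open>v - \<theta> * u = p + c * x\<close>, where \<open>c = b - \<theta> * a\<close>, and a unit
  increase of the parameter adds the lattice vector \<open>(a, b)\<close>. The last assumption expresses that
  the curve is simple on the torus.
\<close>
locale transversal_lift =
  fixes \<theta> p :: real and a b :: int and \<Psi> :: "real \<Rightarrow> real"
  assumes irrational: "\<theta> \<notin> \<rat>"
    and nontrivial: "a \<noteq> 0 \<or> b \<noteq> 0"
    and cont: "continuous_on UNIV \<Psi>"
    and periodic: "\<Psi> (x + 1) = \<Psi> x"
    and embedded: "(\<Psi> x + of_int a * x, \<theta> * (\<Psi> x + of_int a * x) + p + (of_int b - \<theta> * of_int a) * x) -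
        (\<Psi> y + of_int a * y, \<theta> * (\<Psi> y + of_int a * y) + p + (of_int b - \<theta> * of_int a) * y) \<in> \<int> \<times> \<int> \<Longrightarrow> x - y \<in> \<int>"
begin

sublocale periodic_fun_simple' \<Psi> by standard (rule periodic)

definition c :: real where "c = of_int b - \<theta> * of_int a"

definition lift :: "real \<Rightarrow> real \<times> real" where
  "lift x = (\<Psi> x + of_int a * x, \<theta> * (\<Psi> x + of_int a * x) + p + c * x)"

lemma c_nonzero: "c \<noteq> 0"
proof
  assume "c = 0"
  then have eq: "\<theta> * a = b" by (simp add: c_def)
  then have "a \<noteq> 0" using nontrivial by auto
  then have "\<theta> = b / a" using eq by (simp add: field_simps)
  then show False using irrational by simp
qed

lemma lift_embedded: "lift x - lift y \<in> \<int> \<times> \<int> \<Longrightarrow> x - y \<in> \<int>"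
  using embedded[of x y] by (simp add: lift_def c_def)

text \<open>
  Let \<open>d\<close> be the greatest common divisor. The function \<open>\<Psi>\<close> takes the same value at two parameters at
  distance \<open>1 / d\<close>; the corresponding points of the lift differ by \<open>(a / d, b / d)\<close>, a lattice vector.
  Simplicity makes \<open>1 / d\<close> an integer.
\<close>
lemma coprime_winding: "coprime a b"
proof -
  define d where "d = gcd a b"
  have d: "d > 0" using nontrivial by (simp add: d_def)
  obtain a' where a': "a = d * a'" by (metis d_def gcd_dvd1 dvdE)
  obtain b' where b': "b = d * b'" by (metis d_def gcd_dvd2 dvdE)
  obtain x where x: "\<Psi> (x + 1 / d) = \<Psi> x"
    using periodic_one_chord[OF cont periodic] by blast
  have "lift (x + 1 / d) - lift x = (a * (1 / d), b * (1 / d))"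
    by (simp add: lift_def c_def x algebra_simps)
  also have "\<dots> = (of_int a', of_int b')"
    using d arg_cong[OF a', of real_of_int] arg_cong[OF b', of real_of_int] by simp
  finally have "lift (x + 1 / d) - lift x = (of_int a', of_int b')" .
  then have "lift (x + 1 / d) - lift x \<in> \<int> \<times> \<int>" by simp
  then have "1 / real_of_int d \<in> \<int>" using lift_embedded[of "x + 1 / d" x] by simp
  then obtain n :: int where "1 / real_of_int d = of_int n" by (rule Ints_cases)
  then have "real_of_int (n * d) = 1" using d by (simp add: field_simps)
  then have "n * d = 1" by linarith
  then have "d = 1" using d zmult_eq_1_iff by auto
  then show ?thesis by (simp add: d_def coprime_iff_gcd_eq_1)
qed

text \<open>
  A vector that completes \<open>(a, b)\<close> to a basis of the lattice; its multiples number the lattice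
  translates of the lift.
\<close>
definition transverse :: "int \<times> int" where
  "transverse = (SOME m. b * fst m - a * snd m = 1)"

abbreviation m1 :: int where "m1 \<equiv> fst transverse"
abbreviation m2 :: int where "m2 \<equiv> snd transverse"

lemma transverse: "b * m1 - a * m2 = 1"
proof -
  obtain u v where "u * a + v * b = 1"
    using bezout_int[of a b] coprime_winding by (auto simp: coprime_iff_gcd_eq_1)
  then have "b * fst (v, -u) - a * snd (v, -u) = 1" by (simp add: algebra_simps)
  then show ?thesis unfolding transverse_def by (rule someI)
qed

text \<open>
  The shift of the transversal parameter between consecutive translates of the lift.
\<close>
definition \<alpha> :: real where "\<alpha> = (\<theta> * m1 - m2) / c"

definition \<Phi> :: "real \<Rightarrow> real" where "\<Phi> x = \<Psi> (x - p / c) - of_int a * p / c"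

lemma c_\<alpha>: "c * \<alpha> = \<theta> * m1 - m2"
  using c_nonzero by (simp add: \<alpha>_def)

lemma a_\<alpha>: "m1 + a * \<alpha> = 1 / c"
proof -
  have "c * (m1 + a * \<alpha>) = c * m1 + a * (c * \<alpha>)" by (simp add: algebra_simps)
  also have "\<dots> = real_of_int (b * m1 - a * m2)"
    unfolding c_\<alpha> by (simp add: c_def algebra_simps)
  also have "\<dots> = 1" by (simp only: transverse of_int_1)
  finally show ?thesis using c_nonzero by (simp add: field_simps)
qed

text \<open>
  Since \<open>m1 + a * \<alpha> = 1 / c\<close> and \<open>c * \<alpha> = \<theta> * m1 - m2\<close>, rationality of \<open>\<alpha>\<close> would pass to \<open>c\<close> and then
  to \<open>\<theta>\<close>, as \<open>a\<close> and \<open>m1\<close> cannot both vanish.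
\<close>
lemma \<alpha>_irrational: "\<alpha> \<notin> \<rat>"
proof
  assume "\<alpha> \<in> \<rat>"
  then have "m1 + a * \<alpha> \<in> \<rat>" by simp
  then have "inverse (1 / c) \<in> \<rat>" unfolding a_\<alpha> by (rule Rats_inverse)
  then have cQ: "c \<in> \<rat>" by simp
  have "a = 0"
  proof (rule ccontr)
    assume "a \<noteq> 0"
    then have "\<theta> = (b - c) / a" by (simp add: c_def)
    also have "\<dots> \<in> \<rat>" by (intro Rats_divide Rats_diff Rats_of_int cQ)
    finally show False using irrational by simp
  qed
  then have "m1 \<noteq> 0" using transverse by auto
  then have "\<theta> = (c * \<alpha> + m2) / m1" by (simp add: c_\<alpha>)
  also have "\<dots> \<in> \<rat>" by (intro Rats_divide Rats_add Rats_mult Rats_of_int cQ \<open>\<alpha> \<in> \<rat>\<close>)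
  finally show False using irrational by simp
qed

text \<open>
  A collision would put two points of the lift at parameter distance \<open>\<alpha>\<close> in the same class modulo the
  lattice, contrary to simplicity because \<open>\<alpha>\<close> is no integer.
\<close>
lemma \<Phi>_no_collision: "1 / c + \<Phi> (x + \<alpha>) - \<Phi> x \<noteq> 0"
proof
  define y where "y = x - p / c"
  assume "1 / c + \<Phi> (x + \<alpha>) - \<Phi> x = 0"
  then have eq: "\<Psi> (y + \<alpha>) = \<Psi> y - m1 - a * \<alpha>"
    using a_\<alpha> by (simp add: \<Phi>_def y_def algebra_simps)
  have "lift (y + \<alpha>) - lift y = (- of_int m1, - \<theta> * m1 + c * \<alpha>)"
    by (simp add: lift_def eq algebra_simps)
  also have "\<dots> = (of_int (- m1), of_int (- m2))" by (simp add: c_\<alpha>)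
  finally have "lift (y + \<alpha>) - lift y \<in> \<int> \<times> \<int>" by simp
  then have "\<alpha> \<in> \<int>" using lift_embedded[of "y + \<alpha>" y] by simp
  then show False using \<alpha>_irrational Ints_subset_Rats by blast
qed

lemma \<Phi>_cont: "continuous_on UNIV \<Phi>"
  unfolding \<Phi>_def by (intro continuous_intros continuous_on_compose2[OF cont]) auto

lemma \<Phi>_periodic: "\<Phi> (x + 1) = \<Phi> x"
  using periodic[of "x - p / c"] by (simp add: \<Phi>_def algebra_simps)

lemma line_meets_lift_iff:
  "slope_line \<theta> t = (of_int n1, of_int n2) + lift x \<longleftrightarrow>
     t = n1 + of_int a * x + \<Psi> x \<and> c * x = \<theta> * n1 - n2 - p"
  by (auto simp: slope_line_def lift_def algebra_simps)

text \<open>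
  The key computation: in the basis formed by the transverse vector and \<open>(a, b)\<close>, the hitting time
  depends only on the coordinate \<open>k\<close>, while \<open>j\<close> merely shifts the parameter at which the lift is
  met.
\<close>
lemma lattice_coordinates:
  fixes k j :: int
  shows "slope_line \<theta> t = (of_int (k * m1 + j * a), of_int (k * m2 + j * b)) + lift x \<longleftrightarrow>
     t = of_int k / c + \<Phi> (of_int k * \<alpha>) \<and> x = of_int k * \<alpha> - p / c - of_int j"
proof -
  have "\<theta> * of_int (k * m1 + j * a) - of_int (k * m2 + j * b) - p = k * (c * \<alpha>) - j * c - p"
    unfolding c_\<alpha> by (simp add: c_def algebra_simps)
  also have "\<dots> = c * (k * \<alpha> - p / c - j)" using c_nonzero by (simp add: algebra_simps)
  finally have x: "c * x = \<theta> * of_int (k * m1 + j * a) - of_int (k * m2 + j * b) - p \<longleftrightarrow>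
      x = k * \<alpha> - p / c - j" using c_nonzero by simp
  have t: "of_int (k * m1 + j * a) + of_int a * x + \<Psi> x = k / c + \<Phi> (k * \<alpha>)"
    if "x = k * \<alpha> - p / c - j"
  proof -
    have "of_int (k * m1 + j * a) + of_int a * x = k * (m1 + a * \<alpha>) - of_int a * p / c"
      by (simp add: that algebra_simps)
    also have "\<dots> = k / c - of_int a * p / c" unfolding a_\<alpha> by simp
    finally have *: "of_int (k * m1 + j * a) + of_int a * x = k / c - of_int a * p / c" .
    have "\<Psi> x = \<Psi> (k * \<alpha> - p / c)" unfolding that by (rule minus_of_int)
    with * show ?thesis by (simp add: \<Phi>_def)
  qed
  show ?thesis unfolding line_meets_lift_iff x by (metis t)
qed

lemma hits_eq_range:
  "{t. \<exists>z\<in>\<int> \<times> \<int>. \<exists>x\<in>{0..1}. slope_line \<theta> t = z + lift x} = range (\<lambda>k::int. of_int k / c + \<Phi> (of_int k * \<alpha>))"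
proof (intro equalityI subsetI)
  fix t assume "t \<in> {t. \<exists>z\<in>\<int> \<times> \<int>. \<exists>x\<in>{0..1}. slope_line \<theta> t = z + lift x}"
  then obtain z x where z: "z \<in> \<int> \<times> \<int>" and t: "slope_line \<theta> t = z + lift x" by blast
  obtain n1 n2 :: int where n: "z = (of_int n1, of_int n2)"
    using z by (auto elim!: Ints_cases)
  \<comment> \<open>Cramer's rule for the coordinates of \<open>(n1, n2)\<close>, the determinant being one.\<close>
  define k j where "k = b * n1 - a * n2" and "j = m1 * n2 - m2 * n1"
  have "k * m1 + j * a = (b * m1 - a * m2) * n1" "k * m2 + j * b = (b * m1 - a * m2) * n2"
    by (simp_all add: k_def j_def algebra_simps)
  then have "n1 = k * m1 + j * a" "n2 = k * m2 + j * b" unfolding transverse by simp_all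
  then have "t = of_int k / c + \<Phi> (of_int k * \<alpha>)"
    using t lattice_coordinates[of t k j x] unfolding n by simp
  then show "t \<in> range (\<lambda>k::int. of_int k / c + \<Phi> (of_int k * \<alpha>))" by blast
next
  fix t assume "t \<in> range (\<lambda>k::int. of_int k / c + \<Phi> (of_int k * \<alpha>))"
  then obtain k :: int where k: "t = of_int k / c + \<Phi> (of_int k * \<alpha>)" by blast
  \<comment> \<open>The choice of \<open>j\<close> that brings the parameter into the unit interval.\<close>
  define j where "j = \<lfloor>of_int k * \<alpha> - p / c\<rfloor>"
  have "of_int k * \<alpha> - p / c - j \<in> {0..1}"
    unfolding j_def by (auto; linarith)
  moreover have "(real_of_int (k * m1 + j * a), real_of_int (k * m2 + j * b)) \<in> \<int> \<times> \<int>" by simp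
  ultimately show "t \<in> {t. \<exists>z\<in>\<int> \<times> \<int>. \<exists>x\<in>{0..1}. slope_line \<theta> t = z + lift x}"
    using lattice_coordinates[of t k j] k by blast
qed

text \<open>
  When \<open>c\<close> is negative the hitting times decrease with \<open>k\<close>; reversing the numbering replaces
  \<open>1 / c\<close> and \<open>\<alpha>\<close> by their negatives.
\<close>
lemma hits_modulated_lattice:
  obtains r \<beta> where "modulated_lattice r \<beta> \<Phi>" "\<beta> \<notin> \<rat>"
    "{t. \<exists>z\<in>\<int> \<times> \<int>. \<exists>x\<in>{0..1}. slope_line \<theta> t = z + lift x} = range (modulated_lattice.pt r \<beta> \<Phi>)"
proof (cases "c > 0")
  case True
  then interpret modulated_lattice "1 / c" \<alpha> \<Phi>
    using \<Phi>_cont \<Phi>_periodic \<Phi>_no_collision by unfold_locales auto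
  have "pt = (\<lambda>k. of_int k / c + \<Phi> (of_int k * \<alpha>))" by (simp add: pt_def fun_eq_iff)
  then show ?thesis
    using that[OF modulated_lattice_axioms \<alpha>_irrational] hits_eq_range by simp
next
  case False
  then have "c < 0" using c_nonzero by simp
  then interpret modulated_lattice "- (1 / c)" "- \<alpha>" \<Phi>
  proof unfold_locales
    show "- (1 / c) + \<Phi> (x + - \<alpha>) - \<Phi> x \<noteq> 0" for x
      using \<Phi>_no_collision[of "x - \<alpha>"] by (simp add: algebra_simps)
  qed (use \<Phi>_cont \<Phi>_periodic in \<open>auto simp: divide_neg_neg\<close>)
  have "range pt = range (\<lambda>k::int. of_int k / c + \<Phi> (of_int k * \<alpha>))"
  proof -
    have "pt = (\<lambda>k::int. of_int k / c + \<Phi> (of_int k * \<alpha>)) \<circ> uminus" by (rule ext) (simp add: pt_def)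
    moreover have "range (uminus :: int \<Rightarrow> int) = UNIV" by (rule surjI[of _ uminus]) simp
    ultimately show ?thesis by (simp only: image_comp[symmetric])
  qed
  moreover have "- \<alpha> \<notin> \<rat>" using \<alpha>_irrational by (simp add: Rats_minus_iff)
  ultimately show ?thesis
    using that[OF modulated_lattice_axioms] hits_eq_range by simp
qed

lemma constant_imp_collinear:
  assumes "\<And>x. \<Phi> x = \<Phi> 0"
  shows "collinear (lift ` A)"
  unfolding collinear_def
proof (rule exI, intro ballI)
  fix P Q assume "P \<in> lift ` A" "Q \<in> lift ` A"
  then obtain x y where PQ: "P = lift x" "Q = lift y" by blast
  have "\<Psi> x = \<Psi> y" using assms[of "x + p / c"] assms[of "y + p / c"] by (simp add: \<Phi>_def)
  then have "P - Q = (x - y) *\<^sub>R (of_int a, of_int b)"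
    by (simp add: PQ lift_def c_def algebra_simps)
  then show "\<exists>s. P - Q = s *\<^sub>R (real_of_int a, real_of_int b)" by blast
qed

end

text \<open>
  Along the curve \<open>f\<close> is locally injective: nearby points with equal \<open>f\<close> lie on a common flow line, less than
  the time \<open>\<epsilon>\<close> apart, hence coincide, and then simplicity identifies their parameters. So \<open>f\<close> is
  injective, its rescaling \<open>q\<close> is a homeomorphism of the unit interval, and the inverse \<open>u\<close> of \<open>q\<close>
  reparametrises the curve. Subtracting the linear drift \<open>a * x\<close> from the first coordinate equalises
  the end values, which leaves a function that extends periodically.
\<close>
lemma transversal_curve_lift:
  fixes g :: "real \<Rightarrow> real \<times> real"
  assumes irr: "\<theta> \<notin> \<rat>"
    and cont: "continuous_on {0..1} g"
    and transversal: "\<exists>\<epsilon>>0. \<forall>p\<in>g ` {0..1}. \<forall>t. p + slope_line \<theta> t \<in> g ` {0..1} \<longrightarrow> t = 0 \<or> \<bar>t\<bar> > \<epsilon>"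
    and closed_mod: "g 1 - g 0 \<in> \<int> \<times> \<int>"
    and simple_mod: "\<forall>s\<in>{0..1}. \<forall>s'\<in>{0..1}. s < s' \<longrightarrow> g s - g s' \<in> \<int> \<times> \<int> \<longrightarrow> s = 0 \<and> s' = 1"
  obtains p a b \<Psi> where "transversal_lift \<theta> p a b \<Psi>"
    "g ` {0..1} = transversal_lift.lift \<theta> p a b \<Psi> ` {0..1}"
proof -
  define f where "f s = snd (g s) - \<theta> * fst (g s)" for s
  have contf: "continuous_on {0..1} f" unfolding f_def by (intro continuous_intros cont)
  obtain \<epsilon> where \<epsilon>: "\<epsilon> > 0" "\<And>s s' t. s \<in> {0..1} \<Longrightarrow> s' \<in> {0..1} \<Longrightarrow> g s' = g s + slope_line \<theta> t \<Longrightarrow>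
      t = 0 \<or> \<bar>t\<bar> > \<epsilon>"
    using transversal by (metis imageI)
  have "uniformly_continuous_on {0..1} g" using cont by (rule compact_uniformly_continuous) simp
  then obtain d where d: "d > 0"
    "\<And>s s'. s \<in> {0..1} \<Longrightarrow> s' \<in> {0..1} \<Longrightarrow> dist s' s < d \<Longrightarrow> dist (g s') (g s) < \<epsilon>"
    unfolding uniformly_continuous_on_def using \<epsilon>(1) by metis
  have simple: "s = s' \<or> \<bar>s - s'\<bar> = 1" if "s \<in> {0..1}" "s' \<in> {0..1}" "g s - g s' \<in> \<int> \<times> \<int>" for s s'
  proof -
    have "g s' - g s = - (g s - g s')" by simp
    then have neg: "g s' - g s \<in> \<int> \<times> \<int>"
      using that(3) Ints_minus by (metis mem_Times_iff fst_uminus snd_uminus)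
    consider "s < s'" | "s' < s" | "s = s'" by linarith
    then show ?thesis
    proof cases
      case 1
      have "s = 0 \<and> s' = 1" by (rule simple_mod[rule_format, OF that(1,2) 1 that(3)])
      then show ?thesis by simp
    next
      case 2
      have "s' = 0 \<and> s = 1" by (rule simple_mod[rule_format, OF that(2,1) 2 neg])
      then show ?thesis by simp
    qed simp
  qed
  have injf: "inj_on f {0..1}"
  \<comment> \<open>The scale is at most one, which keeps the two end parameters \<open>0\<close> and \<open>1\<close> from being compared.\<close>
  proof (rule locally_injective_imp_inj_on[OF contf, of "min d 1"])
    show "min d 1 > 0" using d(1) by simp
    fix s s' :: real assume s: "s \<in> {0..1}" "s' \<in> {0..1}" "\<bar>s - s'\<bar> < min d 1" "f s = f s'"
    define t where "t = fst (g s') - fst (g s)"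
    have eq: "g s' = g s + slope_line \<theta> t"
      using s(4) by (auto simp: f_def t_def slope_line_def prod_eq_iff algebra_simps)
    have "\<bar>t\<bar> \<le> dist (g s') (g s)" unfolding t_def using dist_fst_le[of "g s'" "g s"] by (simp add: dist_real_def)
    then have "\<bar>t\<bar> < \<epsilon>" using d(2)[OF s(1,2)] s(3) by (simp add: dist_real_def abs_minus_commute)
    then have "t = 0" using \<epsilon>(2)[OF s(1,2) eq] by simp
    then have "g s' = g s" using eq by (simp add: slope_line_def prod_eq_iff)
    then have "g s - g s' \<in> \<int> \<times> \<int>" by (simp add: zero_prod_def)
    then show "s = s'" using simple[OF s(1,2)] s(3) by auto
  qed
  obtain a b :: int where ab: "g 1 - g 0 = (of_int a, of_int b)"
    using closed_mod by (auto elim!: Ints_cases)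
  define p where "p = f 0"
  define c where "c = real_of_int b - \<theta> * of_int a"
  have g1: "fst (g 1) = fst (g 0) + a" "snd (g 1) = snd (g 0) + b"
    using ab by (auto simp: prod_eq_iff)
  have f1: "f 1 = p + c" by (simp add: f_def p_def c_def g1 algebra_simps)
  have c0: "c \<noteq> 0"
  proof
    assume "c = 0"
    then have "f 1 = f 0" using f1 by (simp add: p_def)
    then show False using inj_onD[OF injf, of 1 0] by simp
  qed
  define q where "q s = (f s - p) / c" for s
  have contq: "continuous_on {0..1} q" unfolding q_def by (intro continuous_intros contf) (simp add: c0)
  have injq: "inj_on q {0..1}" using injf c0 by (auto simp: q_def inj_on_def)
  have q01: "q 0 = 0" "q 1 = 1" using f1 c0 by (simp_all add: q_def p_def)
  have range_q: "q ` {0..1} = {0..1}"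
  proof (intro equalityI subsetI)
    fix y assume "y \<in> q ` {0..1}"
    then obtain s where s: "s \<in> {0..1}" "y = q s" by blast
    show "y \<in> {0..1}"
    proof (cases "s = 0 \<or> s = 1")
      case False
      then have "q 0 < q s \<and> q s < q 1 \<or> q 1 < q s \<and> q s < q 0"
        using s(1) contq injq by (intro continuous_inj_imp_mono) auto
      then show ?thesis using q01 s(2) by auto
    qed (use q01 s in auto)
  next
    fix y :: real assume "y \<in> {0..1}"
    then show "y \<in> q ` {0..1}" using IVT'[of q 0 y 1] contq q01 by fastforce
  qed
  define u where "u = inv_into {0..1} q"
  have u: "u x \<in> {0..1}" "q (u x) = x" if "x \<in> {0..1}" for x
    using inv_into_into[of x q "{0..1}"] f_inv_into_f[of x q "{0..1}"] that
    unfolding range_q u_def by blast+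
  have uq: "u (q s) = s" if "s \<in> {0..1}" for s using that injq by (simp add: u_def)
  have contu: "continuous_on {0..1} u"
    using continuous_on_inv[OF contq, of u] uq range_q by auto
  have u01: "u 0 = 0" "u 1 = 1" using uq[of 0] uq[of 1] q01 by auto
  define \<Psi>0 where "\<Psi>0 x = fst (g (u x)) - of_int a * x" for x
  have cont\<Psi>0: "continuous_on {0..1} \<Psi>0"
    unfolding \<Psi>0_def using u(1)
    by (intro continuous_intros continuous_on_compose2[OF cont contu]) auto
  have \<Psi>01: "\<Psi>0 0 = \<Psi>0 1" by (simp add: \<Psi>0_def u01 g1)
  define \<Psi> where "\<Psi> x = \<Psi>0 (frac x)" for x
  define E where "E x = (\<Psi> x + of_int a * x, \<theta> * (\<Psi> x + of_int a * x) + p + (of_int b - \<theta> * of_int a) * x)" for x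
  have E_unit: "E x = g (u x)" if "x \<in> {0..1}" for x
  proof -
    have "\<Psi> x = \<Psi>0 x"
    proof (cases "x = 1")
      case False
      then have "frac x = x" using that by (simp add: frac_eq)
      then show ?thesis by (simp add: \<Psi>_def)
    qed (simp add: \<Psi>_def \<Psi>01)
    then have *: "\<Psi> x + of_int a * x = fst (g (u x))" by (simp add: \<Psi>0_def)
    have "f (u x) = p + c * x" using u(2)[OF that] c0 by (simp add: q_def field_simps)
    then show ?thesis unfolding E_def * by (simp add: f_def c_def prod_eq_iff)
  qed
  have E_frac: "E x = E (frac x) + (of_int (\<lfloor>x\<rfloor> * a), of_int (\<lfloor>x\<rfloor> * b))" for x
    by (simp add: E_def \<Psi>_def frac_def algebra_simps)
  have fr: "frac x \<in> {0..1}" for x :: real by (simp add: less_imp_le[OF frac_lt_1])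
  have embedded: "x - y \<in> \<int>" if "E x - E y \<in> \<int> \<times> \<int>" for x y
  proof -
    have "E (frac x) - E (frac y) = (E x - E y)
        + (of_int (\<lfloor>y\<rfloor> * a - \<lfloor>x\<rfloor> * a), of_int (\<lfloor>y\<rfloor> * b - \<lfloor>x\<rfloor> * b))"
      using E_frac[of x] E_frac[of y] by (simp add: prod_eq_iff)
    also have "\<dots> \<in> \<int> \<times> \<int>"
      unfolding mem_Times_iff fst_add snd_add fst_conv snd_conv
      using that by (intro conjI Ints_add Ints_of_int) (simp_all add: mem_Times_iff)
    finally have "g (u (frac x)) - g (u (frac y)) \<in> \<int> \<times> \<int>" using E_unit fr by metis
    then have cases: "u (frac x) = u (frac y) \<or> \<bar>u (frac x) - u (frac y)\<bar> = 1"
      by (rule simple[OF u(1)[OF fr] u(1)[OF fr]])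
    have lt1: "u (frac z) \<noteq> 1" for z
    proof
      assume "u (frac z) = 1"
      then have "frac z = 1" using u(2)[OF fr, of z] q01(2) by simp
      then show False using frac_lt_1[of z] by simp
    qed
    then have "u (frac z) \<in> {0..<1}" for z using u(1)[OF fr, of z] by (simp add: less_le)
    from this[of x] this[of y] have "\<bar>u (frac x) - u (frac y)\<bar> < 1" by (simp add: abs_less_iff)
    then have "u (frac x) = u (frac y)" using cases by simp
    then have "frac x = frac y" using u(2) fr by metis
    then have "x - y = of_int (\<lfloor>x\<rfloor> - \<lfloor>y\<rfloor>)" by (simp add: frac_def)
    then show ?thesis by simp
  qed
  interpret T: transversal_lift \<theta> p a b \<Psi>
  proof
    show "\<theta> \<notin> \<rat>" by (rule irr)
    show "a \<noteq> 0 \<or> b \<noteq> 0" using c0 by (auto simp: c_def)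
    show "continuous_on UNIV \<Psi>"
      unfolding \<Psi>_def by (rule continuous_on_periodic_extension[OF cont\<Psi>0 \<Psi>01])
    show "\<Psi> (x + 1) = \<Psi> x" for x by (simp add: \<Psi>_def frac_1_eq)
    show "x - y \<in> \<int>"
      if "(\<Psi> x + of_int a * x, \<theta> * (\<Psi> x + of_int a * x) + p + (of_int b - \<theta> * of_int a) * x) -
          (\<Psi> y + of_int a * y, \<theta> * (\<Psi> y + of_int a * y) + p + (of_int b - \<theta> * of_int a) * y)
          \<in> \<int> \<times> \<int>" for x y
      using that unfolding E_def[symmetric] by (rule embedded)
  qed
  have "T.lift = E" by (rule ext) (simp add: T.lift_def E_def T.c_def)
  moreover have "g ` {0..1} = E ` {0..1}"
  proof -
    have "s \<in> u ` {0..1}" if "s \<in> {0..1}" for s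
      using uq[OF that] range_q that by (metis imageI)
    then have "u ` {0..1} = {0..1}" using u(1) by blast
    then have "g ` {0..1} = (\<lambda>x. g (u x)) ` {0..1}" by (metis image_image)
    then show ?thesis using E_unit by simp
  qed
  ultimately show ?thesis using that[OF T.transversal_lift_axioms] by simp
qed

theorem corollary6p1:
  fixes \<theta> :: real and g :: "real \<Rightarrow> real \<times> real"
  assumes theta_pos: "0 < \<theta>" and theta_less_1: "\<theta> < 1" and theta_irrational: "\<theta> \<notin> \<rat>"
    and cont: "continuous_on {0..1} g"
    and transversal: "\<exists>\<epsilon>>0. \<forall>p\<in>g ` {0..1}. \<forall>t. p + slope_line \<theta> t \<in> g ` {0..1} \<longrightarrow> t = 0 \<or> \<bar>t\<bar> > \<epsilon>"
    and closed_mod: "g 1 - g 0 \<in> \<int> \<times> \<int>"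
    and simple_mod: "\<forall>s\<in>{0..1}. \<forall>s'\<in>{0..1}. s < s' \<longrightarrow> g s - g s' \<in> \<int> \<times> \<int> \<longrightarrow> s = 0 \<and> s' = 1"
    and nonlinear: "\<not> collinear (g ` {0..1})"
  shows "Delone (hitting_set g \<theta>) \<and>
    strongly_almost_periodic (Dirac_comb (hitting_set g \<theta>)) \<and>
    \<not> completely_periodic (hitting_set g \<theta>)"
proof -
  obtain p a b \<Psi> where "transversal_lift \<theta> p a b \<Psi>"
    and img: "g ` {0..1} = transversal_lift.lift \<theta> p a b \<Psi> ` {0..1}"
    using transversal_curve_lift[OF theta_irrational cont transversal closed_mod simple_mod] .
  then interpret L: transversal_lift \<theta> p a b \<Psi> by simp
  have hit: "hitting_set g \<theta> = {t. \<exists>z\<in>\<int> \<times> \<int>. \<exists>x\<in>{0..1}. slope_line \<theta> t = z + L.lift x}"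
    unfolding hitting_set_def lattice_translates_def img by blast
  obtain r \<beta> where "modulated_lattice r \<beta> L.\<Phi>" and irr: "\<beta> \<notin> \<rat>"
    and "{t. \<exists>z\<in>\<int> \<times> \<int>. \<exists>x\<in>{0..1}. slope_line \<theta> t = z + L.lift x}
      = range (modulated_lattice.pt r \<beta> L.\<Phi>)"
    by (rule L.hits_modulated_lattice)
  then interpret M: modulated_lattice r \<beta> L.\<Phi> by simp
  have range: "hitting_set g \<theta> = range M.pt" unfolding hit by fact
  obtain x where "L.\<Phi> x \<noteq> L.\<Phi> 0"
    using L.constant_imp_collinear[of "{0..1}"] nonlinear img by metis
  then show ?thesis
    unfolding range
    using M.Delone_pt M.strongly_almost_periodic_pt M.not_completely_periodic_pt[OF irr] by blast
qed

end
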